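(* For all $k,N,M\in\mathbb{N}$ with $N\le M$, $$G_{k,N,M}(x)=D_{k,N}(x)\prod_{j=N}^{M-1}\frac{1+x^{(k+1)(N+j)}}{1-x^{(k+1)j+1}}$$ as formal power series in $x$. Consequently, the following two assertions are equivalent: (1) for all $a,b,m,N,M\in\mathbb{N}$ with $b\mid a$, $a+b=m$ and $N\le M$, one has $g_{a,b,m}(N,M;q)\in\mathbb{N}_0[[q]]$; (2) for all $k,N\in\mathbb{N}$, one has $D_{k,N}(x)\in\mathbb{N}_0[[x]]$.
   Context: $\mathbb{N}$ is the set of positive integers and $\mathbb{N}_0=\mathbb{N}\cup\{0\}$. Notation: $(z;q)_n=\prod_{i=0}^{n-1}(1-zq^i)$. For $a,b,m,N,M\in\mathbb{N}$, $$g_{a,b,m}(N,M;q):=\frac{(-q^m;q^m)_{N+M-1}}{(-q^a;q^m)_N\,(q^b;q^m)_M}.$$ For $k,N,M\in\mathbb{N}$, $$G_{k,N,M}(x):=\frac{(-x^{k+1};x^{k+1})_{N+M-1}}{(-x^{k};x^{k+1})_N\,(x;x^{k+1})_M},\qquad D_{k,N}(x):=G_{k,N,N}(x).$$ (So $G_{k,N,M}(q^b)=g_{a,b,a+b}(N,M;q)$ when $a=kb$.) All quotients are expanded as formal power series; $\mathbb{N}_0[[x]]$ is the set of power series with non-negative integer coefficients. Empty products equal $1$. *)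

theory Defs
  imports "HOL-Computational_Algebra.Formal_Power_Series"
begin

definition qpochhammer :: "'a::comm_ring_1 \<Rightarrow> 'a \<Rightarrow> nat \<Rightarrow> 'a" where
  "qpochhammer z q n = (\<Prod>i<n. 1 - z * q ^ i)"

text \<open>
  Power series are taken over the rationals, where the library provides division of formal power
  series. All denominators below have constant term 1 (when the exponents \<open>a\<close>, \<open>b\<close>, \<open>m\<close>, \<open>k\<close> are
  positive), so each quotient is the usual formal power series expansion.
  The truncated subtraction \<open>N + M - 1\<close> is the intended one for \<open>N, M \<ge> 1\<close>.
\<close>

definition g :: "nat \<Rightarrow> nat \<Rightarrow> nat \<Rightarrow> nat \<Rightarrow> nat \<Rightarrow> rat fps" where
  "g a b m N M =
     qpochhammer (- (fps_X ^ m)) (fps_X ^ m) (N + M - 1) /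
     (qpochhammer (- (fps_X ^ a)) (fps_X ^ m) N * qpochhammer (fps_X ^ b) (fps_X ^ m) M)"

definition G :: "nat \<Rightarrow> nat \<Rightarrow> nat \<Rightarrow> rat fps" where
  "G k N M =
     qpochhammer (- (fps_X ^ (k + 1))) (fps_X ^ (k + 1)) (N + M - 1) /
     (qpochhammer (- (fps_X ^ k)) (fps_X ^ (k + 1)) N * qpochhammer fps_X (fps_X ^ (k + 1)) M)"

definition D :: "nat \<Rightarrow> nat \<Rightarrow> rat fps" where
  "D k N = G k N N"

definition nonneg_int_fps :: "rat fps set" where
  "nonneg_int_fps = {F. \<forall>n. fps_nth F n \<in> \<nat>}"

end

theory Submission
  imports Defs
begin

text \<open>Raising \<open>M\<close> by one adds one factor to the numerator of
  \<open>G k N M\<close> and one to its denominator (\<open>G_Suc\<close>); iterating from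
  \<open>M = N\<close> gives the product formula. Each quotient in it is a binomial times a
  geometric series, so it has coefficients in \<open>\<nat>\<close>, and \<open>G k N M\<close>
  inherits this from \<open>D k N\<close>. If \<open>a = k * b\<close> and \<open>m = a + b\<close>,
  then \<open>g a b m\<close> is \<open>G k\<close> with \<open>fps_X ^ b\<close> substituted for
  the variable (\<open>g_eq_G_compose\<close>), which preserves such coefficients. Conversely,
  \<open>D\<close> is itself a value of \<open>g\<close>.\<close>

lemma qpochhammer_Suc: "qpochhammer z q (Suc n) = qpochhammer z q n * (1 - z * q ^ n)"
  by (simp add: qpochhammer_def)

text \<open>Makes the denominators units, so that division is multiplication by an inverse.\<close>

lemma qpochhammer_nth_0:
  fixes z q :: "'a::comm_ring_1 fps"
  assumes "fps_nth z 0 = 0"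
  shows "fps_nth (qpochhammer z q n) 0 = 1"
  using assms by (induction n) (simp_all add: qpochhammer_Suc, simp add: qpochhammer_def)

text \<open>Substituting a series without constant term is a ring homomorphism.\<close>

lemma qpochhammer_compose:
  fixes z q h :: "'a::idom fps"
  assumes "fps_nth h 0 = 0"
  shows "qpochhammer z q n oo h = qpochhammer (z oo h) (q oo h) n"
  using assms
  by (simp add: qpochhammer_def fps_compose_prod_distrib fps_compose_sub_distrib
      fps_compose_mult_distrib fps_compose_power)

text \<open>The case \<open>b = 1\<close>, from which nonnegativity of \<open>D\<close> is read
  off.\<close>

lemma G_eq_g: "G k N M = g k 1 (k + 1) N M"
  by (simp add: G_def g_def)

lemma G_Suc:
  assumes "k \<ge> 1" "N \<ge> 1"
  shows "G k N (Suc M) =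
    G k N M * ((1 + fps_X ^ ((k + 1) * (N + M))) / (1 - fps_X ^ ((k + 1) * M + 1)))"
proof -
  define A where "A = qpochhammer (- (fps_X ^ (k+1))) (fps_X ^ (k+1) :: rat fps) (N + M - 1)"
  define B where "B = qpochhammer (- (fps_X ^ k)) (fps_X ^ (k+1) :: rat fps) N"
  define C where "C = qpochhammer fps_X (fps_X ^ (k+1) :: rat fps) M"
  define P :: "rat fps" where "P = 1 + fps_X ^ ((k + 1) * (N + M))"
  define Q :: "rat fps" where "Q = 1 - fps_X ^ ((k + 1) * M + 1)"
  have units: "fps_nth B 0 = 1" "fps_nth C 0 = 1" "fps_nth Q 0 = 1"
    using assms by (simp_all add: B_def C_def Q_def qpochhammer_nth_0)
  \<comment> \<open>The new numerator factor has index \<open>N + M - 1\<close>;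
    \<open>N \<ge> 1\<close> keeps this subtraction from truncating.\<close>
  have exponent: "(k + 1) + (k + 1) * (N + M - 1) = (k + 1) * (N + M)"
    using assms(2) by (cases N) simp_all
  have "1 - (- (fps_X ^ (k+1))) * (fps_X ^ (k+1)) ^ (N + M - 1) = P"
    by (simp only: P_def exponent [symmetric] power_add power_mult) simp
  moreover have "N + Suc M - 1 = Suc (N + M - 1)"
    using assms(2) by simp
  ultimately have "qpochhammer (- (fps_X ^ (k+1))) (fps_X ^ (k+1)) (N + Suc M - 1) = A * P"
    by (simp only: qpochhammer_Suc A_def)
  moreover have "qpochhammer fps_X (fps_X ^ (k+1)) (Suc M) = C * Q"
    by (simp only: qpochhammer_Suc C_def Q_def power_add power_mult power_one_right
        mult.commute [of fps_X])
  ultimately have "G k N (Suc M) = (A * P) / (B * (C * Q))"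
    by (simp only: G_def B_def)
  also have "\<dots> = A / (B * C) * (P / Q)"
    using units by (simp add: fps_divide_unit fps_inverse_mult mult_ac)
  finally show ?thesis
    by (simp only: G_def A_def B_def C_def P_def Q_def)
qed

lemma G_eq_D_prod:
  assumes "k \<ge> 1" "N \<ge> 1" "N \<le> M"
  shows "G k N M =
    D k N * (\<Prod>j\<in>{N..<M}. (1 + fps_X ^ ((k + 1) * (N + j))) / (1 - fps_X ^ ((k + 1) * j + 1)))"
  using assms(3)
proof (induction M rule: dec_induct)
  case base
  show ?case by (simp add: D_def)
next
  case (step M)
  then show ?case
    by (simp only: G_Suc [OF assms(1,2)] prod.atLeastLessThan_Suc mult.assoc)
qed

lemma g_eq_G_compose:
  assumes "k \<ge> 1" "b \<ge> 1"
  shows "g (k * b) b (k * b + b) N M = G k N M oo fps_X ^ b"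
proof -
  have X_power: "fps_X ^ i oo fps_X ^ b = (fps_X ^ (i * b) :: rat fps)" for i
    using assms by (simp add: fps_compose_power [symmetric] mult.commute flip: power_mult)
  show ?thesis
    \<comment> \<open>The instance at 1 covers the bare \<open>fps_X\<close> in the denominator of
      \<open>G\<close>.\<close>
    using assms X_power [of 1]
    by (simp add: g_def G_def fps_divide_unit qpochhammer_nth_0 fps_compose_mult_distrib
        fps_inverse_compose qpochhammer_compose fps_compose_uminus X_power add.commute
        del: power_Suc)
qed

lemma nonneg_int_fps_1: "1 \<in> nonneg_int_fps"
  by (simp add: nonneg_int_fps_def)

lemma nonneg_int_fps_add: "F \<in> nonneg_int_fps \<Longrightarrow> H \<in> nonneg_int_fps \<Longrightarrow> F + H \<in> nonneg_int_fps"
  by (simp add: nonneg_int_fps_def)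

lemma Nats_sum: "(\<And>i. i \<in> I \<Longrightarrow> f i \<in> \<nat>) \<Longrightarrow> sum f I \<in> \<nat>"
  by (induction I rule: infinite_finite_induct) auto

lemma nonneg_int_fps_mult: "F \<in> nonneg_int_fps \<Longrightarrow> H \<in> nonneg_int_fps \<Longrightarrow> F * H \<in> nonneg_int_fps"
  by (simp add: nonneg_int_fps_def fps_mult_nth Nats_sum)

lemma nonneg_int_fps_prod:
  "(\<And>i. i \<in> I \<Longrightarrow> F i \<in> nonneg_int_fps) \<Longrightarrow> prod F I \<in> nonneg_int_fps"
  by (induction I rule: infinite_finite_induct)
    (simp_all add: nonneg_int_fps_1 nonneg_int_fps_mult)

lemma nonneg_int_fps_X_power: "fps_X ^ n \<in> nonneg_int_fps"
  by (simp add: nonneg_int_fps_def fps_X_power_nth)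

text \<open>Each coefficient of \<open>F oo H\<close> is a finite sum of coefficients of
  \<open>F\<close> times coefficients of powers of \<open>H\<close>.\<close>

lemma nonneg_int_fps_compose:
  assumes "F \<in> nonneg_int_fps" "H \<in> nonneg_int_fps"
  shows "F oo H \<in> nonneg_int_fps"
proof -
  have "H ^ i \<in> nonneg_int_fps" for i
    using nonneg_int_fps_prod [of "{..<i}" "\<lambda>_. H"] assms(2) by simp
  with assms(1) show ?thesis
    by (simp add: nonneg_int_fps_def fps_compose_nth Nats_sum)
qed

text \<open>This is the geometric series with \<open>fps_X ^ n\<close> substituted for the
  variable.\<close>

lemma nonneg_int_fps_inverse_one_minus_X_power:
  assumes "n \<ge> 1"
  shows "inverse (1 - fps_X ^ n) \<in> nonneg_int_fps"
proof -
  have "inverse (1 - fps_X) = (Abs_fps (\<lambda>_. 1) :: rat fps)"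
    by (metis fps_inverse_gp' fps_inverse_idempotent fps_nth_Abs_fps one_neq_zero)
  then have "inverse (1 - fps_X) \<in> nonneg_int_fps"
    by (simp add: nonneg_int_fps_def)
  moreover have "inverse (1 - fps_X ^ n) = (inverse (1 - fps_X) oo fps_X ^ n :: rat fps)"
    using assms by (simp add: fps_inverse_compose fps_compose_sub_distrib)
  ultimately show ?thesis
    using assms by (simp add: nonneg_int_fps_compose nonneg_int_fps_X_power)
qed

lemma nonneg_int_fps_G:
  assumes "k \<ge> 1" "N \<ge> 1" "N \<le> M" "D k N \<in> nonneg_int_fps"
  shows "G k N M \<in> nonneg_int_fps"
proof -
  \<comment> \<open>The exponent \<open>j + 1\<close> is positive and matches
    \<open>(k + 1) * j + 1\<close> in the product formula.\<close>
  have "(1 + fps_X ^ i) / (1 - fps_X ^ (j + 1)) \<in> nonneg_int_fps" for i j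
    using nonneg_int_fps_inverse_one_minus_X_power [of "j + 1"]
    by (simp add: fps_divide_unit nonneg_int_fps_mult nonneg_int_fps_add nonneg_int_fps_1
        nonneg_int_fps_X_power del: power_Suc)
  then show ?thesis
    unfolding G_eq_D_prod [OF assms(1-3)]
    by (intro nonneg_int_fps_mult nonneg_int_fps_prod assms(4))
qed

theorem theorem1p3:
  "(\<forall>k N M :: nat. k \<ge> 1 \<and> N \<ge> 1 \<and> M \<ge> 1 \<and> N \<le> M \<longrightarrow>
      G k N M =
        D k N * (\<Prod>j\<in>{N..<M}. (1 + fps_X ^ ((k + 1) * (N + j))) / (1 - fps_X ^ ((k + 1) * j + 1))))
   \<and>
   ((\<forall>a b m N M :: nat.
       a \<ge> 1 \<and> b \<ge> 1 \<and> m \<ge> 1 \<and> N \<ge> 1 \<and> M \<ge> 1 \<and> b dvd a \<and> a + b = m \<and> N \<le> M \<longrightarrow>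
       g a b m N M \<in> nonneg_int_fps)
    \<longleftrightarrow>
    (\<forall>k N :: nat. k \<ge> 1 \<and> N \<ge> 1 \<longrightarrow> D k N \<in> nonneg_int_fps))"
  (is "?identity \<and> (?g_nonneg \<longleftrightarrow> ?D_nonneg)")
proof (intro conjI iffI)
  show ?identity
    using G_eq_D_prod by blast
next
  assume ?g_nonneg
  \<comment> \<open>Take \<open>a = k\<close>, \<open>b = 1\<close>, \<open>m = k + 1\<close> and
    \<open>M = N\<close>.\<close>
  then show ?D_nonneg
    unfolding D_def G_eq_g by (metis le_add2 le_refl one_dvd)
next
  assume D: ?D_nonneg
  show ?g_nonneg
  proof (intro allI impI, elim conjE)
    fix a b m N M :: nat
    assume a: "a \<ge> 1" and b: "b \<ge> 1" and N: "N \<ge> 1" "N \<le> M" and "b dvd a" and m: "a + b = m"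
    then obtain k where k: "a = k * b"
      by (metis dvd_def mult.commute)
    \<comment> \<open>\<open>k = 0\<close> would give \<open>a = 0\<close>.\<close>
    with a have "k \<ge> 1"
      by (cases k) simp_all
    with D N b show "g a b m N M \<in> nonneg_int_fps"
      by (simp add: k m [symmetric] g_eq_G_compose nonneg_int_fps_G
          nonneg_int_fps_compose nonneg_int_fps_X_power)
  qed
qed

end
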